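(* Let $f:\mathbb{R}^n\to\mathbb{R}$ be locally Lipschitz continuous, assume that the set $\Omega^2$ of points at which $f$ is not twice differentiable is a Lebesgue null set, and assume that for all $x\in\mathbb{R}^n$ there is an open set $V\ni x$ such that $\{\nabla^2 f(y): y\in V\setminus\Omega^2\}$ is bounded. Then for all inputs $x\in\mathbb{R}^n$, $c\in(0,1)$, $\varepsilon>0$, $\tau>0$, the sampling scheme for the second-order $\varepsilon$-jet (defined in the context) terminates, i.e., it stops after finitely many iterations.
   Context: Notation. $\|\cdot\|$ is the Euclidean norm and $B_\delta(x)=\{y\in\mathbb{R}^n:\|x-y\|\le\delta\}$. Second-order $\varepsilon$-jet. For $x\in\mathbb{R}^n$, $\varepsilon\ge0$, $$\mathcal{J}^2_\varepsilon f(x)=\bigcap_{\delta>\varepsilon}\overline{\{(y,f(y),\nabla f(y),\nabla^2 f(y)): y\in B_\delta(x)\setminus\Omega^2\}}\subseteq\mathbb{R}^n\times\mathbb{R}\times\mathbb{R}^n\times\mathbb{R}^{n\times n}.$$ Model. For a finite nonempty $W\subseteq\mathcal{J}^2_\varepsilon f(x)$ let $$\mathcal{T}^W_{x,\varepsilon}(z)=\max_{(y,f(y),\xi,\mathcal{H})\in W} f(y)+\xi^\top(z-y)+\tfrac12(z-y)^\top\mathcal{H}(z-y),$$ let $\bar z^W(x,\varepsilon)$ be an arbitrary (global) minimizer of $\mathcal{T}^W_{x,\varepsilon}$ over $B_\varepsilon(x)$, and let $\theta^W(x,\varepsilon)=\mathcal{T}^W_{x,\varepsilon}(\bar z^W(x,\varepsilon))$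 be the minimal value. Sampling scheme (inputs $x\in\mathbb{R}^n$, $c\in(0,1)$, $\varepsilon>0$, $\tau>0$): 1. Pick an arbitrary element $J_x=(x,f(x),\xi_x,\mathcal{H}_x)\in\mathcal{J}^2_0 f(x)$ and set $W=\{J_x\}$. 2. Compute $\theta^W=\theta^W(x,\varepsilon)$ and $\bar z^W=\bar z^W(x,\varepsilon)$. 3. If $(\theta^W-f(x))/\varepsilon>-\tau$ or $f(\bar z^W)\le c\,\theta^W+(1-c)f(x)$, stop. 4. Otherwise pick an arbitrary element $J_{\bar z^W}=(\bar z^W,f(\bar z^W),\xi_{\bar z^W},\mathcal{H}_{\bar z^W})\in\mathcal{J}^2_0 f(\bar z^W)$, replace $W$ by $W\cup\{J_{\bar z^W}\}$, and go to 2. *)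

theory Defs
  imports "HOL-Analysis.Analysis"
begin

definition locally_lipschitz :: "('a::metric_space \<Rightarrow> 'b::metric_space) \<Rightarrow> bool" where
  "locally_lipschitz f \<longleftrightarrow> (\<forall>x. \<exists>U L. open U \<and> x \<in> U \<and> L-lipschitz_on U f)"

definition gradient :: "(real^'n \<Rightarrow> real) \<Rightarrow> real^'n \<Rightarrow> real^'n" where
  "gradient f x = (THE g. GDERIV f x :> g)"

text \<open>Classical (Frechet) second-order differentiability: the gradient exists on a whole
  neighbourhood of the point and is differentiable there.\<close>

definition twice_differentiable_at :: "(real^'n \<Rightarrow> real) \<Rightarrow> real^'n \<Rightarrow> bool" where
  "twice_differentiable_at f x \<longleftrightarrow>
     (\<forall>\<^sub>F y in nhds x. f differentiable (at y)) \<and> gradient f differentiable (at x)"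

definition hessian :: "(real^'n \<Rightarrow> real) \<Rightarrow> real^'n \<Rightarrow> real^'n^'n" where
  "hessian f x = jacobian (gradient f) (at x)"

definition Omega2 :: "(real^'n \<Rightarrow> real) \<Rightarrow> (real^'n) set" where
  "Omega2 f = {x. \<not> twice_differentiable_at f x}"

type_synonym 'n jet = "(real^'n) \<times> real \<times> (real^'n) \<times> (real^'n^'n)"

definition eps_jet2 :: "(real^'n \<Rightarrow> real) \<Rightarrow> real \<Rightarrow> real^'n \<Rightarrow> 'n::finite jet set" where
  "eps_jet2 f \<epsilon> x =
     (\<Inter>\<delta>\<in>{\<epsilon><..}. closure ((\<lambda>y. (y, f y, gradient f y, hessian f y)) ` (cball x \<delta> - Omega2 f)))"

text \<open>Only meaningful for finite nonempty \<open>W\<close>, as \<^const>\<open>Max\<close> is unspecified otherwise; the sets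
  occurring in the sampling scheme are always of this kind.\<close>

definition jet_model :: "'n::finite jet set \<Rightarrow> real^'n \<Rightarrow> real" where
  "jet_model W z =
     Max ((\<lambda>(y, v, \<xi>, H). v + \<xi> \<bullet> (z - y) + 1/2 * ((z - y) \<bullet> (H *v (z - y)))) ` W)"

definition model_minimizer :: "real^'n \<Rightarrow> real \<Rightarrow> 'n::finite jet set \<Rightarrow> real^'n \<Rightarrow> bool" where
  "model_minimizer x \<epsilon> W z \<longleftrightarrow> is_arg_min (jet_model W) (\<lambda>y. y \<in> cball x \<epsilon>) z"

text \<open>The scheme is nondeterministic. A state is the current sample set \<open>W\<close>; in each iteration
  a minimizer \<open>z\<close> of the model and, unless the stopping test succeeds, a jet element based at
  \<open>z\<close> are chosen arbitrarily. The minimal model value is \<open>jet_model W z\<close>.\<close>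

definition stopping_test ::
    "(real^'n \<Rightarrow> real) \<Rightarrow> real^'n \<Rightarrow> real \<Rightarrow> real \<Rightarrow> real \<Rightarrow> 'n::finite jet set \<Rightarrow> real^'n \<Rightarrow> bool" where
  "stopping_test f x c \<epsilon> \<tau> W z \<longleftrightarrow>
     (jet_model W z - f x) / \<epsilon> > - \<tau> \<or> f z \<le> c * jet_model W z + (1 - c) * f x"

definition sampling_init :: "(real^'n \<Rightarrow> real) \<Rightarrow> real^'n \<Rightarrow> 'n::finite jet set \<Rightarrow> bool" where
  "sampling_init f x W \<longleftrightarrow> (\<exists>\<xi> H. (x, f x, \<xi>, H) \<in> eps_jet2 f 0 x \<and> W = {(x, f x, \<xi>, H)})"

definition sampling_step ::
    "(real^'n \<Rightarrow> real) \<Rightarrow> real^'n \<Rightarrow> real \<Rightarrow> real \<Rightarrow> real \<Rightarrow> 'n::finite jet set \<Rightarrow> 'n jet set \<Rightarrow> bool" where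
  "sampling_step f x c \<epsilon> \<tau> W W' \<longleftrightarrow>
     (\<exists>z \<xi> H. model_minimizer x \<epsilon> W z \<and> \<not> stopping_test f x c \<epsilon> \<tau> W z \<and>
        (z, f z, \<xi>, H) \<in> eps_jet2 f 0 z \<and> W' = insert (z, f z, \<xi>, H) W)"

text \<open>An execution stops only by passing the stopping test. So besides excluding infinite
  executions, one has to exclude executions in which a required choice is impossible. A step with
  \<open>W' = W\<close> counts as an iteration, so repeated samples do not end an execution.\<close>

definition sampling_never_stuck ::
    "(real^'n::finite \<Rightarrow> real) \<Rightarrow> real^'n \<Rightarrow> real \<Rightarrow> real \<Rightarrow> real \<Rightarrow> bool" where
  "sampling_never_stuck f x c \<epsilon> \<tau> \<longleftrightarrow>
     (\<exists>W. sampling_init f x W) \<and>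
     (\<forall>W\<^sub>0 W. sampling_init f x W\<^sub>0 \<longrightarrow> (sampling_step f x c \<epsilon> \<tau>)\<^sup>*\<^sup>* W\<^sub>0 W \<longrightarrow>
        (\<exists>z. model_minimizer x \<epsilon> W z) \<and>
        (\<forall>z. model_minimizer x \<epsilon> W z \<longrightarrow>
           stopping_test f x c \<epsilon> \<tau> W z \<or> (\<exists>\<xi> H. (z, f z, \<xi>, H) \<in> eps_jet2 f 0 z)))"

definition sampling_terminates ::
    "(real^'n::finite \<Rightarrow> real) \<Rightarrow> real^'n \<Rightarrow> real \<Rightarrow> real \<Rightarrow> real \<Rightarrow> bool" where
  "sampling_terminates f x c \<epsilon> \<tau> \<longleftrightarrow>
     sampling_never_stuck f x c \<epsilon> \<tau> \<and>
     \<not> (\<exists>W. sampling_init f x (W 0) \<and> (\<forall>k::nat. sampling_step f x c \<epsilon> \<tau> (W k) (W (Suc k))))"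

end

theory Submission
  imports Defs
begin

text \<open>Suppose that the scheme runs forever, with minimizers \<open>z\<^sub>k\<close> and model values \<open>\<theta>\<^sub>k\<close>. The failed
  stopping test gives \<open>f z\<^sub>k > \<theta>\<^sub>k + (1 - c) (f x - \<theta>\<^sub>k) \<ge> \<theta>\<^sub>k + (1 - c) \<epsilon> \<tau>\<close>. For \<open>j < k\<close> the sample
  at \<open>z\<^sub>j\<close> belongs to the \<open>k\<close>-th model, and near an accumulation point the sampled gradients and
  Hessians are bounded, so \<open>\<theta>\<^sub>k \<ge> f z\<^sub>j - O(\<parallel>z\<^sub>k - z\<^sub>j\<parallel>)\<close>. Along a convergent subsequence the
  values \<open>f z\<^sub>k - f z\<^sub>j\<close> would then stay bounded away from 0, which contradicts continuity.\<close>

section \<open>Norms of matrices and gradients; continuity\<close>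

lemma norm_matrix_vector_le: "norm (A *v x) \<le> norm A * norm x" for A :: "real^'n^'m"
proof -
  have "norm (A *v x) = L2_set (\<lambda>i. \<bar>A $ i \<bullet> x\<bar>) UNIV"
    by (simp add: norm_vec_def matrix_vector_mult_def inner_vec_def)
  \<comment> \<open>The matrix norm here is the Frobenius norm, so Cauchy-Schwarz can be applied row
    by row.\<close>
  also have "\<dots> \<le> L2_set (\<lambda>i. norm (A $ i) * norm x) UNIV"
    by (intro L2_set_mono) (auto simp: Cauchy_Schwarz_ineq2)
  also have "\<dots> = norm A * norm x"
    by (simp add: norm_vec_def[of A] L2_set_left_distrib)
  finally show ?thesis .
qed

text \<open>The definite description in \<open>gradient\<close> is justified by Riesz representation
  (existence) and uniqueness of the Frechet derivative.\<close>

lemma GDERIV_gradient: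
  assumes "f differentiable (at y)"
  shows "GDERIV f y :> gradient f y"
proof -
  obtain f' where f': "(f has_derivative f') (at y)"
    using assms unfolding differentiable_def by blast
  then have lin: "linear f'" by (rule has_derivative_linear)
  \<comment> \<open>The adjoint, evaluated at 1, is the Riesz vector of the functional
    \<open>f'\<close>.\<close>
  define g where "g = adjoint f' 1"
  have "f' = (\<lambda>h. h \<bullet> g)"
    using adjoint_works[OF lin, of _ 1] by (auto simp: g_def)
  with f' have g: "GDERIV f y :> g" by (simp add: gderiv_def)
  have "h = g" if "GDERIV f y :> h" for h
  proof -
    have "(\<lambda>v. v \<bullet> h) = (\<lambda>v. v \<bullet> g)"
      using that g unfolding gderiv_def by (rule has_derivative_unique)
    then have "v \<bullet> h = v \<bullet> g" for v by (rule fun_cong)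
    then show ?thesis using vector_eq_ldot by blast
  qed
  with g show ?thesis unfolding gradient_def by (rule theI)
qed

text \<open>Along its own gradient \<open>f\<close> grows to first order at rate
  \<open>norm g\<close>, and no rate can exceed the Lipschitz constant.\<close>

lemma norm_GDERIV_le_lipschitz:
  assumes lip: "L-lipschitz_on U f" and "open U" "y \<in> U" and g: "GDERIV f y :> g"
  shows "norm g \<le> L"
proof (cases "g = 0")
  case True
  then show ?thesis using lipschitz_on_nonneg[OF lip] by simp
next
  case False
  show ?thesis
  proof (rule field_le_epsilon)
    fix e :: real assume "e > 0"
    then obtain d where "d > 0"
      and d: "\<And>z. norm (z - y) < d \<Longrightarrow> norm (f z - f y - (z - y) \<bullet> g) \<le> e * norm (z - y)"
      using g unfolding gderiv_def has_derivative_at_alt by meson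
    obtain s where "s > 0" and s: "ball y s \<subseteq> U"
      using \<open>open U\<close> \<open>y \<in> U\<close> open_contains_ball by meson
    \<comment> \<open>Moving by \<open>t *\<^sub>R g\<close> has length \<open>min d s / 2\<close>:
      short enough for the derivative estimate and for staying in \<open>U\<close>.\<close>
    define t where "t = min d s / (2 * norm g)"
    define z where "z = y + t *\<^sub>R g"
    have "t > 0" using \<open>d > 0\<close> \<open>s > 0\<close> False by (simp add: t_def)
    have n: "norm (z - y) = t * norm g" using \<open>t > 0\<close> by (simp add: z_def)
    also have "\<dots> < min d s" using False \<open>d > 0\<close> \<open>s > 0\<close> by (simp add: t_def min_def)
    finally have small: "norm (z - y) < d" "norm (z - y) < s" by auto
    then have "z \<in> U" using s by (auto simp: dist_norm norm_minus_commute)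
    then have "\<bar>f z - f y\<bar> \<le> L * norm (z - y)"
      using lipschitz_onD[OF lip _ \<open>y \<in> U\<close>, of z] by (simp add: dist_norm)
    moreover have "\<bar>f z - f y - (z - y) \<bullet> g\<bar> \<le> e * norm (z - y)"
      using d[OF small(1)] by simp
    ultimately have "(z - y) \<bullet> g \<le> (L + e) * norm (z - y)"
      by (simp add: distrib_right)
    moreover have "(z - y) \<bullet> g = norm g * norm (z - y)"
      using n \<open>t > 0\<close> by (simp add: z_def power2_norm_eq_inner[symmetric] power2_eq_square)
    moreover have "norm (z - y) > 0" using n \<open>t > 0\<close> False by simp
    ultimately show "norm g \<le> L + e" by simp
  qed
qed

lemma locally_lipschitz_continuous:
  assumes "locally_lipschitz f"
  shows "isCont f x"
  using assms unfolding locally_lipschitz_def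
  by (metis continuous_on_eq_continuous_at lipschitz_on_continuous_on)

section \<open>Local boundedness of second-order jets\<close>

lemma gradient_hessian_locally_bounded:
  fixes f :: "real^'n \<Rightarrow> real"
  assumes "locally_lipschitz f"
    and "\<forall>y. \<exists>V. open V \<and> y \<in> V \<and> bounded (hessian f ` (V - Omega2 f))"
  obtains r B where "r > 0"
    "\<And>y. y \<in> ball p r - Omega2 f \<Longrightarrow> norm (gradient f y) \<le> B \<and> norm (hessian f y) \<le> B"
proof -
  obtain U L where U: "open U" "p \<in> U" "L-lipschitz_on U f"
    using assms(1) unfolding locally_lipschitz_def by blast
  obtain V where V: "open V" "p \<in> V" "bounded (hessian f ` (V - Omega2 f))"
    using assms(2) by blast
  obtain M where M: "\<And>y. y \<in> V - Omega2 f \<Longrightarrow> norm (hessian f y) \<le> M"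
    using V(3) unfolding bounded_iff by blast
  obtain r where r: "r > 0" "ball p r \<subseteq> U \<inter> V"
    using U V open_contains_ball[of "U \<inter> V"] by blast
  have "norm (gradient f y) \<le> max L M \<and> norm (hessian f y) \<le> max L M"
    if y: "y \<in> ball p r - Omega2 f" for y
  proof
    \<comment> \<open>The filter \<open>nhds\<close> includes the point itself, so differentiability
      near \<open>y\<close> covers \<open>y\<close>.\<close>
    have "f differentiable (at y)"
      using y eventually_nhds_x_imp_x by (auto simp: Omega2_def twice_differentiable_at_def)
    then have "norm (gradient f y) \<le> L"
      using y r by (intro norm_GDERIV_le_lipschitz[OF U(3,1) _ GDERIV_gradient]) auto
    then show "norm (gradient f y) \<le> max L M" by simp
    have "norm (hessian f y) \<le> M" using M y r by blast
    then show "norm (hessian f y) \<le> max L M" by simp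
  qed
  with r(1) show thesis by (rule that)
qed

text \<open>The bounds at points outside \<open>Omega2 f\<close> pass to limits because closed balls
  are closed. As the jet is an intersection, a single small \<delta> suffices.\<close>

lemma eps_jet2_locally_bounded:
  fixes f :: "real^'n \<Rightarrow> real"
  assumes "locally_lipschitz f"
    and "\<forall>y. \<exists>V. open V \<and> y \<in> V \<and> bounded (hessian f ` (V - Omega2 f))"
  obtains r B where "r > 0"
    "\<And>z y v \<xi> H. z \<in> ball p r \<Longrightarrow> (y, v, \<xi>, H) \<in> eps_jet2 f 0 z \<Longrightarrow> norm \<xi> \<le> B \<and> norm H \<le> B"
proof -
  obtain r B where r: "r > 0"
    and B: "\<And>y. y \<in> ball p r - Omega2 f \<Longrightarrow> norm (gradient f y) \<le> B \<and> norm (hessian f y) \<le> B"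
    using gradient_hessian_locally_bounded[OF assms] by metis
  have "norm \<xi> \<le> B \<and> norm H \<le> B"
    if z: "z \<in> ball p r" and J: "(y, v, \<xi>, H) \<in> eps_jet2 f 0 z" for z y v \<xi> H
  proof -
    obtain \<delta> where \<delta>: "\<delta> > 0" "cball z \<delta> \<subseteq> ball p r"
      using z open_ball open_contains_cball by meson
    let ?C = "UNIV \<times> UNIV \<times> cball 0 B \<times> cball 0 B :: 'n jet set"
    have "(y, v, \<xi>, H) \<in>
        closure ((\<lambda>y. (y, f y, gradient f y, hessian f y)) ` (cball z \<delta> - Omega2 f))"
      using J \<delta>(1) unfolding eps_jet2_def by simp
    moreover have "\<dots> \<subseteq> ?C"
      using B \<delta>(2) by (intro closure_minimal closed_Times closed_UNIV closed_cball) auto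
    ultimately show ?thesis by auto
  qed
  with r show thesis by (rule that)
qed

section \<open>Nonemptiness of the jet\<close>

text \<open>The complement of a null set is dense, so \<open>z\<close> is a limit of points with
  gradient and Hessian. Local boundedness gives a convergent subsequence of these, and continuity of
  \<open>f\<close> makes the value component converge to \<open>f z\<close>.\<close>

lemma eps_jet2_0_nonempty:
  fixes f :: "real^'n \<Rightarrow> real"
  assumes "locally_lipschitz f"
    and "Omega2 f \<in> null_sets lebesgue"
    and "\<forall>y. \<exists>V. open V \<and> y \<in> V \<and> bounded (hessian f ` (V - Omega2 f))"
  shows "\<exists>\<xi> H. (z, f z, \<xi>, H) \<in> eps_jet2 f 0 z"
proof -
  obtain r B where r: "r > 0"
    and B: "\<And>y. y \<in> ball z r - Omega2 f \<Longrightarrow> norm (gradient f y) \<le> B \<and> norm (hessian f y) \<le> B"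
    using gradient_hessian_locally_bounded[OF assms(1,3)] by metis
  \<comment> \<open>The radii tend to 0 but never exceed \<open>r\<close>, so the bound
    \<open>B\<close> holds for every chosen point.\<close>
  have "\<exists>y. y \<in> ball z (r / Suc k) - Omega2 f" for k
  proof -
    have "\<not> ball z (r / Suc k) \<subseteq> Omega2 f"
    proof
      assume "ball z (r / Suc k) \<subseteq> Omega2 f"
      then have "negligible (ball z (r / Suc k))"
        using assms(2) by (simp add: negligible_iff_null_sets[symmetric] negligible_subset)
      moreover have "ball z (r / Suc k) \<noteq> {}"
        using r by (subst ball_eq_empty) (simp add: not_le)
      ultimately show False
        using open_not_negligible open_ball by blast
    qed
    then show ?thesis by blast
  qed
  then obtain y where y: "\<And>k. y k \<in> ball z (r / Suc k) - Omega2 f" by metis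
  have y_lim: "y \<longlonglongrightarrow> z"
  proof (rule metric_tendsto_imp_tendsto)
    show "(\<lambda>k. r / Suc k) \<longlonglongrightarrow> 0"
      using LIMSEQ_Suc[OF lim_const_over_n[of r]] by simp
    show "\<forall>\<^sub>F k in sequentially. dist (y k) z \<le> dist (r / Suc k) 0"
      using y r by (intro always_eventually) (auto simp: dist_commute less_imp_le)
  qed
  let ?C = "cball 0 B \<times> cball 0 B :: ((real^'n) \<times> (real^'n^'n)) set"
  have in_C: "(gradient f (y k), hessian f (y k)) \<in> ?C" for k
  proof -
    have "r / Suc k \<le> r" using r by (simp add: field_simps)
    then have "y k \<in> ball z r - Omega2 f" using y[of k] by auto
    then show ?thesis using B by auto
  qed
  have "seq_compact ?C"
    by (intro compact_imp_seq_compact compact_Times compact_cball)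
  then obtain l \<phi> where \<phi>: "strict_mono \<phi>"
    and l: "((\<lambda>k. (gradient f (y k), hessian f (y k))) \<circ> \<phi>) \<longlonglongrightarrow> l"
    by (rule seq_compactE) (use in_C in auto)
  have y_sub: "(y \<circ> \<phi>) \<longlonglongrightarrow> z" using y_lim \<phi> by (rule LIMSEQ_subseq_LIMSEQ)
  have f_sub: "(\<lambda>k. f ((y \<circ> \<phi>) k)) \<longlonglongrightarrow> f z"
    using isCont_tendsto_compose[OF locally_lipschitz_continuous[OF assms(1)] y_sub] .
  let ?J = "\<lambda>y. (y, f y, gradient f y, hessian f y)"
  have lim: "(\<lambda>k. ?J ((y \<circ> \<phi>) k)) \<longlonglongrightarrow> (z, f z, fst l, snd l)"
    using tendsto_Pair[OF y_sub tendsto_Pair[OF f_sub l]] by (simp add: o_def)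
  \<comment> \<open>For each \<delta> a tail of the sequence lies in
    \<open>cball z \<delta>\<close>, which is enough for the limit to be in the closure.\<close>
  have "(z, f z, fst l, snd l) \<in> closure (?J ` (cball z \<delta> - Omega2 f))" if "\<delta> > 0" for \<delta>
  proof (rule Lim_in_closed_set[OF closed_closure _ _ lim])
    have "\<forall>\<^sub>F k in sequentially. dist ((y \<circ> \<phi>) k) z < \<delta>"
      using y_sub that by (rule tendstoD)
    then show "\<forall>\<^sub>F k in sequentially. ?J ((y \<circ> \<phi>) k) \<in> closure (?J ` (cball z \<delta> - Omega2 f))"
    proof eventually_elim
      case (elim k)
      then have "(y \<circ> \<phi>) k \<in> cball z \<delta> - Omega2 f"
        using y[of "\<phi> k"] by (simp add: dist_commute)
      then show ?case by (intro subsetD[OF closure_subset] imageI)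
    qed
  qed simp
  then have "(z, f z, fst l, snd l) \<in> eps_jet2 f 0 z"
    unfolding eps_jet2_def by blast
  then show ?thesis by blast
qed

section \<open>Continuity, minimizers and lower bounds of the model\<close>

lemma continuous_on_Max_image:
  fixes g :: "'i \<Rightarrow> 'a::topological_space \<Rightarrow> real"
  assumes "finite W" "W \<noteq> {}" "\<And>w. w \<in> W \<Longrightarrow> continuous_on S (g w)"
  shows "continuous_on S (\<lambda>z. Max ((\<lambda>w. g w z) ` W))"
  using assms
proof (induction W rule: finite_ne_induct)
  case (insert w W)
  have "(\<lambda>z. Max ((\<lambda>w. g w z) ` insert w W)) = (\<lambda>z. max (g w z) (Max ((\<lambda>w. g w z) ` W)))"
    using insert.hyps by simp
  then show ?case using insert by (auto intro!: continuous_on_max)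
qed simp

lemma continuous_on_jet_model:
  fixes W :: "'a::finite jet set"
  assumes "finite W" "W \<noteq> {}"
  shows "continuous_on S (jet_model W)"
proof -
  have "continuous_on S (\<lambda>z. Max ((\<lambda>w. (case w of (y, v, \<xi>, H) \<Rightarrow>
      v + \<xi> \<bullet> (z - y) + 1/2 * ((z - y) \<bullet> (H *v (z - y))))) ` W))"
  proof (intro continuous_on_Max_image assms)
    fix w :: "'a jet"
    obtain y v \<xi> H where w: "w = (y, v, \<xi>, H)" by (cases w)
    have "continuous_on S (\<lambda>z. H *v (z - y))"
      by (rule linear_continuous_on_compose[OF _ matrix_vector_mul_linear])
        (intro continuous_intros)
    then show "continuous_on S (\<lambda>z. case w of (y, v, \<xi>, H) \<Rightarrow>
        v + \<xi> \<bullet> (z - y) + 1/2 * ((z - y) \<bullet> (H *v (z - y))))"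
      unfolding w prod.case by (intro continuous_intros)
  qed
  then show ?thesis unfolding jet_model_def[abs_def] .
qed

lemma model_minimizer_exists:
  assumes "finite W" "W \<noteq> {}" "\<epsilon> \<ge> 0"
  shows "\<exists>z. model_minimizer x \<epsilon> W z"
proof -
  have "\<exists>z\<in>cball x \<epsilon>. \<forall>y\<in>cball x \<epsilon>. jet_model W z \<le> jet_model W y"
    using assms by (intro continuous_attains_inf continuous_on_jet_model) auto
  then show ?thesis by (auto simp: model_minimizer_def is_arg_min_def not_less)
qed

text \<open>The maximum dominates the quadratic piece based at \<open>y\<close>, whose linear and
  quadratic terms are controlled by Cauchy-Schwarz.\<close>

lemma jet_model_lower_bound:
  assumes "finite W" "(y, v, \<xi>, H) \<in> W" "norm \<xi> \<le> B" "norm H \<le> B"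
  shows "v - B * norm (z - y) - B / 2 * (norm (z - y))\<^sup>2 \<le> jet_model W z"
proof -
  let ?w = "z - y"
  have "v + \<xi> \<bullet> ?w + 1/2 * (?w \<bullet> (H *v ?w)) \<le> jet_model W z"
    unfolding jet_model_def
    by (intro Max_ge finite_imageI assms(1) image_eqI[OF _ assms(2)]) simp
  moreover have "\<bar>\<xi> \<bullet> ?w\<bar> \<le> B * norm ?w"
    using Cauchy_Schwarz_ineq2[of \<xi> ?w] mult_right_mono[OF assms(3), of "norm ?w"] by simp
  moreover have "\<bar>?w \<bullet> (H *v ?w)\<bar> \<le> B * (norm ?w)\<^sup>2"
  proof -
    have "\<bar>?w \<bullet> (H *v ?w)\<bar> \<le> norm ?w * norm (H *v ?w)" by (rule Cauchy_Schwarz_ineq2)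
    also have "\<dots> \<le> norm ?w * (B * norm ?w)"
      using norm_matrix_vector_le[of H ?w] mult_right_mono[OF assms(4), of "norm ?w"]
      by (intro mult_left_mono) auto
    finally show ?thesis by (simp add: power2_eq_square mult_ac)
  qed
  ultimately show ?thesis by linarith
qed

section \<open>Every required choice is possible\<close>

text \<open>This keeps \<open>Max\<close> in \<open>jet_model\<close> meaningful, and the model
  continuous, in every reachable state.\<close>

lemma sampling_reachable_finite:
  assumes "(sampling_step f x c \<epsilon> \<tau>)\<^sup>*\<^sup>* W\<^sub>0 W" "sampling_init f x W\<^sub>0"
  shows "finite W \<and> W \<noteq> {}"
  using assms by (induction rule: rtranclp_induct) (auto simp: sampling_init_def sampling_step_def)

lemma sampling_never_stuck:
  fixes f :: "real^'n \<Rightarrow> real"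
  assumes "locally_lipschitz f"
    and "Omega2 f \<in> null_sets lebesgue"
    and "\<forall>y. \<exists>V. open V \<and> y \<in> V \<and> bounded (hessian f ` (V - Omega2 f))"
    and "\<epsilon> \<ge> 0"
  shows "sampling_never_stuck f x c \<epsilon> \<tau>"
  unfolding sampling_never_stuck_def
proof (intro conjI allI impI)
  note nonempty = eps_jet2_0_nonempty[OF assms(1-3)]
  show "\<exists>W. sampling_init f x W"
    using nonempty[of x] unfolding sampling_init_def by blast
  show "stopping_test f x c \<epsilon> \<tau> W z \<or> (\<exists>\<xi> H. (z, f z, \<xi>, H) \<in> eps_jet2 f 0 z)" for W z
    using nonempty[of z] by blast
next
  fix W\<^sub>0 W
  assume "sampling_init f x W\<^sub>0" "(sampling_step f x c \<epsilon> \<tau>)\<^sup>*\<^sup>* W\<^sub>0 W"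
  then show "\<exists>z. model_minimizer x \<epsilon> W z"
    using sampling_reachable_finite model_minimizer_exists[OF _ _ assms(4)] by metis
qed

section \<open>Exclusion of infinite executions\<close>

text \<open>Failure of the first test bounds the predicted decrease below by
  \<open>\<epsilon> * \<tau>\<close>; failure of the second puts \<open>f z\<close> above the model
  value by more than the fraction \<open>1 - c\<close> of that decrease.\<close>

lemma not_stopping_test_gap:
  assumes "\<not> stopping_test f x c \<epsilon> \<tau> W z" "c \<le> 1" "\<epsilon> > 0"
  shows "jet_model W z + (1 - c) * (\<epsilon> * \<tau>) \<le> f z"
proof -
  have "\<epsilon> * \<tau> \<le> f x - jet_model W z"
    and *: "f z > c * jet_model W z + (1 - c) * f x"
    using assms by (auto simp: stopping_test_def field_simps)
  then have "(1 - c) * (\<epsilon> * \<tau>) \<le> (1 - c) * (f x - jet_model W z)"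
    using assms(2) by (intro mult_left_mono) auto
  with * show ?thesis by (simp add: algebra_simps)
qed

lemma no_infinite_sampling:
  fixes f :: "real^'n \<Rightarrow> real"
  assumes "locally_lipschitz f"
    and "\<forall>y. \<exists>V. open V \<and> y \<in> V \<and> bounded (hessian f ` (V - Omega2 f))"
    and "c < 1" "\<epsilon> > 0" "\<tau> > 0"
    and init: "sampling_init f x (W 0)"
    and step: "\<And>k::nat. sampling_step f x c \<epsilon> \<tau> (W k) (W (Suc k))"
  shows False
proof -
  have "\<forall>k. \<exists>z \<xi> H. z \<in> cball x \<epsilon> \<and> \<not> stopping_test f x c \<epsilon> \<tau> (W k) z \<and>
      (z, f z, \<xi>, H) \<in> eps_jet2 f 0 z \<and> W (Suc k) = insert (z, f z, \<xi>, H) (W k)"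
    using step unfolding sampling_step_def model_minimizer_def is_arg_min_def by blast
  then obtain z \<xi> H where z: "\<And>k. z k \<in> cball x \<epsilon>"
    and test: "\<And>k. \<not> stopping_test f x c \<epsilon> \<tau> (W k) (z k)"
    and J: "\<And>k. (z k, f (z k), \<xi> k, H k) \<in> eps_jet2 f 0 (z k)"
    and W_Suc: "\<And>k. W (Suc k) = insert (z k, f (z k), \<xi> k, H k) (W k)"
    unfolding choice_iff by blast
  have fin: "finite (W k)" for k
    using init by (induction k) (auto simp: sampling_init_def W_Suc)
  have "incseq W" by (intro incseq_SucI) (auto simp: W_Suc)
  \<comment> \<open>Sample \<open>j\<close> enters at \<open>W (Suc j)\<close> and is never
    removed.\<close>
  then have in_W: "(z j, f (z j), \<xi> j, H j) \<in> W k" if "j < k" for j k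
    using incseqD[OF \<open>incseq W\<close> Suc_leI[OF that]] W_Suc[of j] by blast
  define \<gamma> where "\<gamma> = (1 - c) * (\<epsilon> * \<tau>)"
  have "\<gamma> > 0" using assms(3-5) by (simp add: \<gamma>_def)
  have "seq_compact (cball x \<epsilon>)" by (intro compact_imp_seq_compact compact_cball)
  then obtain p \<phi> where \<phi>: "strict_mono \<phi>" and p: "(z \<circ> \<phi>) \<longlonglongrightarrow> p"
    by (rule seq_compactE) (use z in auto)
  \<comment> \<open>One constant \<open>B\<close> now serves all sampled jets near the accumulation
    point \<open>p\<close>, independently of the iteration.\<close>
  obtain r B where "r > 0"
    and B: "\<And>z y v \<xi> H. z \<in> ball p r \<Longrightarrow> (y, v, \<xi>, H) \<in> eps_jet2 f 0 z \<Longrightarrow>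
      norm \<xi> \<le> B \<and> norm H \<le> B"
    using eps_jet2_locally_bounded[OF assms(1,2)] by metis
  define a where "a = z \<circ> \<phi>"
  have a: "a \<longlonglongrightarrow> p" "(\<lambda>k. a (Suc k)) \<longlonglongrightarrow> p"
    using p LIMSEQ_Suc[OF p] by (simp_all add: a_def)
  have fa: "(\<lambda>k. f (a k)) \<longlonglongrightarrow> f p" "(\<lambda>k. f (a (Suc k))) \<longlonglongrightarrow> f p"
    using a by (auto intro: isCont_tendsto_compose[OF locally_lipschitz_continuous[OF assms(1)]])
  define w where "w k = norm (a (Suc k) - a k)" for k
  have w: "w \<longlonglongrightarrow> 0"
    using tendsto_norm[OF tendsto_diff[OF a(2,1)]] by (simp add: w_def[abs_def])
  have "\<forall>\<^sub>F k in sequentially. dist (a k) p < r" using a(1) \<open>r > 0\<close> by (rule tendstoD)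
  then have "\<forall>\<^sub>F k in sequentially. f (a k) - B * w k - B / 2 * (w k)\<^sup>2 + \<gamma> \<le> f (a (Suc k))"
  proof eventually_elim
    case (elim k)
    have "norm (\<xi> (\<phi> k)) \<le> B \<and> norm (H (\<phi> k)) \<le> B"
      using elim J[of "\<phi> k"] by (intro B[of "a k"]) (auto simp: a_def dist_commute)
    \<comment> \<open>Hence the sample taken at \<open>a k\<close> already belongs to the model
      minimized at \<open>a (Suc k)\<close>.\<close>
    moreover have "\<phi> k < \<phi> (Suc k)" using \<phi> by (simp add: strict_mono_Suc_iff)
    ultimately have "f (a k) - B * w k - B / 2 * (w k)\<^sup>2 \<le> jet_model (W (\<phi> (Suc k))) (a (Suc k))"
      unfolding a_def w_def o_def by (intro jet_model_lower_bound[OF fin in_W]) auto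
    moreover have "jet_model (W (\<phi> (Suc k))) (a (Suc k)) + \<gamma> \<le> f (a (Suc k))"
      unfolding a_def o_def \<gamma>_def using assms(3,4) by (intro not_stopping_test_gap[OF test]) auto
    ultimately show ?case by linarith
  qed
  moreover have "(\<lambda>k. f (a k) - B * w k - B / 2 * (w k)\<^sup>2 + \<gamma>) \<longlonglongrightarrow> f p - B * 0 - B / 2 * 0\<^sup>2 + \<gamma>"
    by (intro tendsto_intros fa w)
  \<comment> \<open>Both sides of the eventual inequality converge, and the error terms in
    \<open>w\<close> vanish; what remains is \<open>f p + \<gamma> \<le> f p\<close>.\<close>
  ultimately have "f p - B * 0 - B / 2 * 0\<^sup>2 + \<gamma> \<le> f p"
    using fa(2) by (intro tendsto_le[OF sequentially_bot]) auto
  with \<open>\<gamma> > 0\<close> show False by simp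
qed

theorem theorem12:
  fixes f :: "real^'n \<Rightarrow> real"
    and x :: "real^'n" and c \<epsilon> \<tau> :: real
  assumes "locally_lipschitz f"
    and "Omega2 f \<in> null_sets lebesgue"
    and "\<forall>y. \<exists>V. open V \<and> y \<in> V \<and> bounded (hessian f ` (V - Omega2 f))"
    and "0 < c" and "c < 1" and "\<epsilon> > 0" and "\<tau> > 0"
  shows "sampling_terminates f x c \<epsilon> \<tau>"
  unfolding sampling_terminates_def
proof
  show "sampling_never_stuck f x c \<epsilon> \<tau>"
    using assms(6) by (intro sampling_never_stuck[OF assms(1-3)]) simp
  show "\<not> (\<exists>W. sampling_init f x (W 0) \<and> (\<forall>k. sampling_step f x c \<epsilon> \<tau> (W k) (W (Suc k))))"
    using no_infinite_sampling[OF assms(1,3,5-7)] by blast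
qed

end
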